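(* Let a DC cube be defined by 8 (finite) corner points: $p_0,p_1,p_2,p_4\in\operatorname{Im}\mathbb H$, $p_3$ on the circle $\mathcal C(p_0,p_1,p_2)$, $p_5$ on the circle $\mathcal C(p_0,p_1,p_4)$, $p_6$ on the circle $\mathcal C(p_0,p_2,p_4)$, the associated Miquel point $p_7$, and by an orthonormal frame $(v_1,v_2,v_3=v_1v_2)$ at $p_0$. Let $q_i=(p_i-p_0)^{-1}$ for $i=1,\dots,7$. Then the 8th control point $p_7$ of the DC cube (the analogue of the Miquel point on the plane) can be expressed as $$p_7=p_0+\bigl[q_1+A'(A'-B')^{-1}(q_2-q_1)\bigr]^{-1},$$ where (quaternion products) $$A'=(q_4-q_1)(q_3-q_5)(q_1-q_2),\qquad B'=(q_1-q_2)(q_6-q_3)(q_2-q_4).$$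
   Context: $\mathbb H$ is the algebra of real quaternions. $\operatorname{Im}\mathbb H$ is the space of purely imaginary quaternions, identified with Euclidean $\mathbb R^3$, and $\widehat{\mathbb R}^3=\operatorname{Im}\mathbb H\cup\{\infty\}$. $\mathcal C(p,q,r)$ is the circle through the three points $p,q,r$. DC (Dupin cyclidic) cube: a map $F:[0,1]^3\to\widehat{\mathbb R}^3$, $F=UW^{-1}$ (with value $\infty$ where $W=0$), where $U,W$ are polynomials in the real variables $s,t,u$ with quaternionic coefficients, of degree at most one in each variable, such that $\partial_sF,\partial_tF,\partial_uF$ are mutually orthogonal and the Jacobian of $F$ is not identically zero. Its corner points (which serve as its control points) are $p_{i+2j+4k}=F(i,j,k)$, $i,j,k\in\{0,1\}$. The frame $(v_1,v_2,v_3)$ at $p_0$ means that $v_1,v_2,v_3$ are the tangent directions at $p_0$ of the edges joining $p_0$ to $p_1$, $p_2$, $p_4$ respectively. Miquel point: the common point of the circles $\mathcal C(p_1,p_3,p_5)$, $\mathcal C(p_2,p_3,p_6)$, $\mathcal C(p_4,p_5,p_6)$, provided by Miquel's theorem. *)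

theory Defs
  imports "HOL-Analysis.Analysis"
begin

section \<open>Real quaternions\<close>

datatype quat = Quat (QRe: real) (QI: real) (QJ: real) (QK: real)

lemma quat_eq_iff: "x = y \<longleftrightarrow> QRe x = QRe y \<and> QI x = QI y \<and> QJ x = QJ y \<and> QK x = QK y"
  by (cases x; cases y) simp

instantiation quat :: ab_group_add
begin

definition "0 = Quat 0 0 0 0"
definition "x + y = Quat (QRe x + QRe y) (QI x + QI y) (QJ x + QJ y) (QK x + QK y)"
definition "- x = Quat (- QRe x) (- QI x) (- QJ x) (- QK x)"
definition "x - y = Quat (QRe x - QRe y) (QI x - QI y) (QJ x - QJ y) (QK x - QK y)"

instance
  by standard
    (simp_all add: quat_eq_iff zero_quat_def plus_quat_def uminus_quat_def minus_quat_def)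

end

lemma quat_add_sel [simp]:
  "QRe 0 = 0" "QI 0 = 0" "QJ 0 = 0" "QK 0 = 0"
  "QRe (x + y) = QRe x + QRe y" "QI (x + y) = QI x + QI y"
  "QJ (x + y) = QJ x + QJ y" "QK (x + y) = QK x + QK y"
  "QRe (- x) = - QRe x" "QI (- x) = - QI x" "QJ (- x) = - QJ x" "QK (- x) = - QK x"
  "QRe (x - y) = QRe x - QRe y" "QI (x - y) = QI x - QI y"
  "QJ (x - y) = QJ x - QJ y" "QK (x - y) = QK x - QK y"
  by (simp_all add: zero_quat_def plus_quat_def uminus_quat_def minus_quat_def)

instantiation quat :: real_vector
begin

definition "r *\<^sub>R x = Quat (r * QRe x) (r * QI x) (r * QJ x) (r * QK x)"

instance
  by standard (simp_all add: scaleR_quat_def quat_eq_iff algebra_simps)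

end

lemma quat_scaleR_sel [simp]:
  "QRe (r *\<^sub>R x) = r * QRe x" "QI (r *\<^sub>R x) = r * QI x"
  "QJ (r *\<^sub>R x) = r * QJ x" "QK (r *\<^sub>R x) = r * QK x"
  by (simp_all add: scaleR_quat_def)

instantiation quat :: real_inner
begin

definition "inner x y = QRe x * QRe y + QI x * QI y + QJ x * QJ y + QK x * QK y"
definition "norm (x::quat) = sqrt (inner x x)"
definition "sgn (x::quat) = x /\<^sub>R norm x"
definition "dist x y = norm (x - y :: quat)"
definition [code del]:
  "(uniformity :: (quat \<times> quat) filter) = (INF e\<in>{0 <..}. principal {(x, y). dist x y < e})"
definition [code del]:
  "open (U :: quat set) \<longleftrightarrow> (\<forall>x\<in>U. eventually (\<lambda>(x', y). x' = x \<longrightarrow> y \<in> U) uniformity)"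

instance
proof
  fix x y z :: quat and r :: real and U :: "quat set"
  show "sgn x = x /\<^sub>R norm x" "dist x y = norm (x - y)" "norm x = sqrt (inner x x)"
    by (simp_all add: sgn_quat_def dist_quat_def norm_quat_def)
  show "uniformity = (INF e\<in>{0 <..}. principal {(x::quat, y). dist x y < e})"
    by (rule uniformity_quat_def)
  show "open U \<longleftrightarrow> (\<forall>x\<in>U. eventually (\<lambda>(x', y). x' = x \<longrightarrow> y \<in> U) uniformity)"
    by (rule open_quat_def)
  show "inner x y = inner y x" "inner (x + y) z = inner x z + inner y z"
    "inner (r *\<^sub>R x) y = r * inner x y"
    by (simp_all add: inner_quat_def scaleR_quat_def algebra_simps)
  show "0 \<le> inner x x"
    by (simp add: inner_quat_def)
  show "inner x x = 0 \<longleftrightarrow> x = 0"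
  proof
    assume "inner x x = 0"
    then have "(QRe x * QRe x + QI x * QI x) + (QJ x * QJ x + QK x * QK x) = 0"
      by (simp add: inner_quat_def)
    then show "x = 0"
      by (subst (asm) add_nonneg_eq_0_iff) (auto simp: quat_eq_iff sum_squares_eq_zero_iff)
  qed (simp add: inner_quat_def)
qed

end

instantiation quat :: real_normed_div_algebra
begin

definition "1 = Quat 1 0 0 0"
definition "x * y =
  Quat (QRe x * QRe y - QI x * QI y - QJ x * QJ y - QK x * QK y)
       (QRe x * QI y + QI x * QRe y + QJ x * QK y - QK x * QJ y)
       (QRe x * QJ y - QI x * QK y + QJ x * QRe y + QK x * QI y)
       (QRe x * QK y + QI x * QJ y - QJ x * QI y + QK x * QRe y)"
definition "inverse x = Quat (QRe x) (- QI x) (- QJ x) (- QK x) /\<^sub>R inner x x"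
definition "x div y = x * inverse (y :: quat)"

instance
proof
  fix x y z :: quat and r :: real
  show "x * y * z = x * (y * z)" "(x + y) * z = x * z + y * z" "x * (y + z) = x * y + x * z"
    "1 * x = x" "x * 1 = x" "r *\<^sub>R x * y = r *\<^sub>R (x * y)" "x * r *\<^sub>R y = r *\<^sub>R (x * y)"
    by (simp_all add: quat_eq_iff times_quat_def one_quat_def algebra_simps)
  show "(0::quat) \<noteq> 1"
    by (simp add: quat_eq_iff one_quat_def)
  show "x div y = x * inverse y"
    by (rule divide_quat_def)
  show "inverse (0::quat) = 0"
    by (simp add: quat_eq_iff inverse_quat_def)
  have left: "(Quat (QRe x) (- QI x) (- QJ x) (- QK x)) * x = inner x x *\<^sub>R 1"
    and right: "x * (Quat (QRe x) (- QI x) (- QJ x) (- QK x)) = inner x x *\<^sub>R 1"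
    by (simp_all add: quat_eq_iff times_quat_def one_quat_def inner_quat_def algebra_simps)
  assume "x \<noteq> 0"
  then have "inner x x \<noteq> 0"
    by simp
  moreover have "inverse x * x = (inverse (inner x x) * inner x x) *\<^sub>R 1"
    using arg_cong[OF left, of "scaleR (inverse (inner x x))"]
    by (simp add: inverse_quat_def quat_eq_iff times_quat_def algebra_simps)
  moreover have "x * inverse x = (inverse (inner x x) * inner x x) *\<^sub>R 1"
    using arg_cong[OF right, of "scaleR (inverse (inner x x))"]
    by (simp add: inverse_quat_def quat_eq_iff times_quat_def algebra_simps)
  ultimately show "inverse x * x = 1" "x * inverse x = 1"
    by simp_all
next
  fix x y :: quat
  have "inner (x * y) (x * y) = inner x x * inner y y"
    by (simp add: inner_quat_def times_quat_def algebra_simps)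
  then show "norm (x * y) = norm x * norm y"
    by (simp add: norm_quat_def real_sqrt_mult)
qed

end

section \<open>Imaginary quaternions as Euclidean 3-space, and its circles\<close>

definition ImH :: "quat set" where
  "ImH = {x. QRe x = 0}"

definition im_vec :: "quat \<Rightarrow> real^3" where
  "im_vec x = vector [QI x, QJ x, QK x]"

text \<open>
  A point of the one-point compactification of \<^term>\<open>ImH\<close> is \<^term>\<open>Some x\<close> with
  \<^term>\<open>x \<in> ImH\<close>, or \<^term>\<open>None\<close>, which stands for infinity.
  Straight lines, completed by infinity, count as circles.
\<close>

definition is_circle :: "quat option set \<Rightarrow> bool" where
  "is_circle C \<longleftrightarrow>
     (\<exists>c\<in>ImH. \<exists>n\<in>ImH. \<exists>r>0. n \<noteq> 0 \<and> C = Some ` {x\<in>ImH. inner n (x - c) = 0 \<and> dist x c = r}) \<or>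
     (\<exists>a\<in>ImH. \<exists>d\<in>ImH. d \<noteq> 0 \<and> C = insert None (Some ` range (\<lambda>k::real. a + k *\<^sub>R d)))"

text \<open>Meaningful only for three distinct points.\<close>

definition circle_through :: "quat option \<Rightarrow> quat option \<Rightarrow> quat option \<Rightarrow> quat option set" where
  "circle_through p q r = (THE C. is_circle C \<and> {p, q, r} \<subseteq> C)"

text \<open>
  The arguments are \<open>p\<^sub>1, \<dots>, p\<^sub>6\<close>. Miquel's theorem gives a single common
  point when \<open>p\<^sub>0, p\<^sub>1, p\<^sub>2, p\<^sub>4\<close> are not on one circle; if they are, the three
  circles coincide and there is no Miquel point.
\<close>

definition is_miquel_point ::
    "quat \<Rightarrow> quat \<Rightarrow> quat \<Rightarrow> quat \<Rightarrow> quat \<Rightarrow> quat \<Rightarrow> quat \<Rightarrow> bool" where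
  "is_miquel_point p1 p2 p3 p4 p5 p6 x \<longleftrightarrow>
     circle_through (Some p1) (Some p3) (Some p5) \<inter>
     circle_through (Some p2) (Some p3) (Some p6) \<inter>
     circle_through (Some p4) (Some p5) (Some p6) = {Some x}"

section \<open>Dupin cyclidic cubes\<close>

definition quat_trilinear :: "(real \<Rightarrow> real \<Rightarrow> real \<Rightarrow> quat) \<Rightarrow> bool" where
  "quat_trilinear U \<longleftrightarrow>
     (\<exists>a :: nat \<Rightarrow> nat \<Rightarrow> nat \<Rightarrow> quat. \<forall>s t u.
        U s t u = (\<Sum>i\<le>1. \<Sum>j\<le>1. \<Sum>k\<le>1. (s ^ i * t ^ j * u ^ k) *\<^sub>R a i j k))"

text \<open>
  Partial derivatives on the unit cube, one-sided on its boundary, used only at points where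
  \<open>F\<close> is finite. The maps below are then finite on a neighbourhood, so the
  value of \<^term>\<open>the None\<close> does not matter.
\<close>

definition pd_s :: "(real \<Rightarrow> real \<Rightarrow> real \<Rightarrow> quat option) \<Rightarrow> real \<Rightarrow> real \<Rightarrow> real \<Rightarrow> quat" where
  "pd_s F s t u = vector_derivative (\<lambda>x. the (F x t u)) (at s within {0..1})"

definition pd_t :: "(real \<Rightarrow> real \<Rightarrow> real \<Rightarrow> quat option) \<Rightarrow> real \<Rightarrow> real \<Rightarrow> real \<Rightarrow> quat" where
  "pd_t F s t u = vector_derivative (\<lambda>x. the (F s x u)) (at t within {0..1})"

definition pd_u :: "(real \<Rightarrow> real \<Rightarrow> real \<Rightarrow> quat option) \<Rightarrow> real \<Rightarrow> real \<Rightarrow> real \<Rightarrow> quat" where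
  "pd_u F s t u = vector_derivative (\<lambda>x. the (F s t x)) (at u within {0..1})"

definition jacobian :: "(real \<Rightarrow> real \<Rightarrow> real \<Rightarrow> quat option) \<Rightarrow> real \<Rightarrow> real \<Rightarrow> real \<Rightarrow> real" where
  "jacobian F s t u =
     det (vector [im_vec (pd_s F s t u), im_vec (pd_t F s t u), im_vec (pd_u F s t u)] :: real^3^3)"

text \<open>The values of \<open>F\<close> outside the unit cube are irrelevant.\<close>

definition dc_cube :: "(real \<Rightarrow> real \<Rightarrow> real \<Rightarrow> quat option) \<Rightarrow> bool" where
  "dc_cube F \<longleftrightarrow>
     (\<exists>U W. quat_trilinear U \<and> quat_trilinear W \<and>
        (\<forall>s\<in>{0..1}. \<forall>t\<in>{0..1}. \<forall>u\<in>{0..1}.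
           F s t u = (if W s t u = 0 then None else Some (U s t u * inverse (W s t u))))) \<and>
     (\<forall>s\<in>{0..1}. \<forall>t\<in>{0..1}. \<forall>u\<in>{0..1}. F s t u \<in> insert None (Some ` ImH)) \<and>
     (\<forall>s\<in>{0..1}. \<forall>t\<in>{0..1}. \<forall>u\<in>{0..1}. F s t u \<noteq> None \<longrightarrow>
        inner (pd_s F s t u) (pd_t F s t u) = 0 \<and>
        inner (pd_s F s t u) (pd_u F s t u) = 0 \<and>
        inner (pd_t F s t u) (pd_u F s t u) = 0) \<and>
     (\<exists>s\<in>{0..1}. \<exists>t\<in>{0..1}. \<exists>u\<in>{0..1}. F s t u \<noteq> None \<and> jacobian F s t u \<noteq> 0)"

definition corner_points :: "(real \<Rightarrow> real \<Rightarrow> real \<Rightarrow> quat option) \<Rightarrow> (nat \<Rightarrow> quat) \<Rightarrow> bool" where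
  "corner_points F p \<longleftrightarrow>
     (\<forall>i\<in>{0,1}. \<forall>j\<in>{0,1}. \<forall>k\<in>{0,1}. F (real i) (real j) (real k) = Some (p (i + 2*j + 4*k)))"

text \<open>
  Tangent directions are taken up to sign, so that the right-handedness \<open>v3 = v1 * v2\<close>
  does not restrict the orientation of the cube.
\<close>

definition frame_at_p0 ::
    "(real \<Rightarrow> real \<Rightarrow> real \<Rightarrow> quat option) \<Rightarrow> quat \<Rightarrow> quat \<Rightarrow> quat \<Rightarrow> bool" where
  "frame_at_p0 F v1 v2 v3 \<longleftrightarrow>
     {v1, v2, v3} \<subseteq> ImH \<and> norm v1 = 1 \<and> norm v2 = 1 \<and> norm v3 = 1 \<and>
     inner v1 v2 = 0 \<and> inner v1 v3 = 0 \<and> inner v2 v3 = 0 \<and> v3 = v1 * v2 \<and>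
     (\<exists>c. c \<noteq> 0 \<and> pd_s F 0 0 0 = c *\<^sub>R v1) \<and>
     (\<exists>c. c \<noteq> 0 \<and> pd_t F 0 0 0 = c *\<^sub>R v2) \<and>
     (\<exists>c. c \<noteq> 0 \<and> pd_u F 0 0 0 = c *\<^sub>R v3)"

end

theory Submission
  imports Defs
begin

text \<open>
  Invert at \<open>p\<^sub>0\<close>: the circles through \<open>p\<^sub>0\<close> become the side lines of the triangle
  \<open>q\<^sub>1 q\<^sub>2 q\<^sub>4\<close>, with \<open>q\<^sub>3, q\<^sub>5, q\<^sub>6\<close> on the sides, and \<open>p\<^sub>7\<close> becomes the Miquel
  point of this plane configuration. With \<open>x = q\<^sub>2 - q\<^sub>1\<close> and \<open>y = q\<^sub>4 - q\<^sub>1\<close>, both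
  \<open>A'\<close> and \<open>A' - B'\<close> are explicit real combinations of \<open>x\<close> and \<open>y\<close>, which shows that
  \<open>A' - B' \<noteq> 0\<close> and that the point \<open>M\<close> of the formula is on the circle through
  \<open>q\<^sub>1, q\<^sub>3, q\<^sub>5\<close>. The formula is invariant under permutations of the triangle, so \<open>M\<close>
  is on all three circles. As these have a single common point, it is the inverse of \<open>p\<^sub>7\<close>.
\<close>

section \<open>Arithmetic of imaginary quaternions\<close>

lemma ImH_0 [simp]: "0 \<in> ImH"
  and ImH_add [simp]: "x \<in> ImH \<Longrightarrow> y \<in> ImH \<Longrightarrow> x + y \<in> ImH"
  and ImH_diff [simp]: "x \<in> ImH \<Longrightarrow> y \<in> ImH \<Longrightarrow> x - y \<in> ImH"
  and ImH_minus [simp]: "x \<in> ImH \<Longrightarrow> - x \<in> ImH"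
  and ImH_scaleR [simp]: "x \<in> ImH \<Longrightarrow> r *\<^sub>R x \<in> ImH"
  and ImH_inverse [simp]: "x \<in> ImH \<Longrightarrow> inverse x \<in> ImH"
  by (simp_all add: ImH_def inverse_quat_def)

lemma ImH_inverse_eq: "x \<in> ImH \<Longrightarrow> inverse x = (- 1 / inner x x) *\<^sub>R x"
  by (simp add: ImH_def inverse_quat_def quat_eq_iff field_simps)

lemma ImH_mult_self: "x \<in> ImH \<Longrightarrow> x * x = - inner x x *\<^sub>R 1"
  by (simp add: ImH_def quat_eq_iff times_quat_def one_quat_def inner_quat_def)

lemma ImH_anticomm: "\<lbrakk>x \<in> ImH; y \<in> ImH\<rbrakk> \<Longrightarrow> x * y + y * x = - (2 * inner x y) *\<^sub>R 1"
  by (simp add: ImH_def quat_eq_iff times_quat_def one_quat_def inner_quat_def)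

lemma ImH_mult_orthogonal:
  assumes "x \<in> ImH" "y \<in> ImH" "inner x y = 0"
  shows "x * y \<in> ImH"
  using assms by (simp add: ImH_def times_quat_def inner_quat_def)

lemma inner_mult_orthogonal:
  assumes "x \<in> ImH" "y \<in> ImH"
  shows "inner x (x * y) = 0" "inner y (x * y) = 0"
  using assms by (simp_all add: ImH_def times_quat_def inner_quat_def algebra_simps)

text \<open>Commuting turns the anticommutator into \<open>2 * (w * v)\<close>, so
  \<open>w * v\<close> is real; multiplying by \<open>v\<close> once more isolates
  \<open>w\<close>.\<close>

lemma ImH_commute_parallel:
  assumes "w \<in> ImH" "v \<in> ImH" "v \<noteq> 0" "w * v = v * w"
  shows "w = (inner w v / inner v v) *\<^sub>R v"
proof -
  have "w * v = - inner w v *\<^sub>R 1"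
    using ImH_anticomm[OF assms(1,2)] assms(4)
    by (simp add: quat_eq_iff)
  then have "w * v * v = - inner w v *\<^sub>R v" by simp
  moreover have "w * v * v = - inner v v *\<^sub>R w"
    using ImH_mult_self[OF assms(2)] by (simp add: mult.assoc)
  ultimately have "inner v v *\<^sub>R w = inner w v *\<^sub>R v" by simp
  then have "(1 / inner v v) *\<^sub>R inner v v *\<^sub>R w = (1 / inner v v) *\<^sub>R inner w v *\<^sub>R v" by simp
  then show ?thesis using assms(3) by simp
qed

text \<open>For orthogonal \<open>n\<close> and \<open>c\<close> the product \<open>n * c\<close> is
  their cross product. A vector orthogonal to both factors anticommutes with each of them, hence
  commutes with \<open>n * c\<close>.\<close>

lemma ImH_orthogonal_parallel:
  assumes "w \<in> ImH" "n \<in> ImH" "c \<in> ImH" "n \<noteq> 0" "c \<noteq> 0"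
    and "inner n c = 0" "inner n w = 0" "inner c w = 0"
  shows "\<exists>k. w = k *\<^sub>R (n * c)"
proof -
  have "n * w = - (w * n)" "c * w = - (w * c)"
    using ImH_anticomm[of n w] ImH_anticomm[of c w] assms by (auto simp: eq_neg_iff_add_eq_0)
  have "n * c * w = n * (c * w)" by (simp add: mult.assoc)
  also have "\<dots> = w * n * c"
    unfolding \<open>c * w = _\<close> using \<open>n * w = _\<close> by (simp flip: mult.assoc)
  finally have "w * (n * c) = (n * c) * w" by (simp add: mult.assoc)
  then show ?thesis
    using ImH_commute_parallel[of w "n * c"] assms ImH_mult_orthogonal[of n c] by auto
qed

section \<open>Circles as inverted lines\<close>

text \<open>The way back from the inverted coordinate \<open>m = inverse (x - p)\<close> to the
  point \<open>x\<close>. The case \<open>m = 0\<close> is separate because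
  \<open>inverse 0 = 0\<close> would yield \<open>p\<close> instead of infinity.\<close>

definition inv_point :: "quat \<Rightarrow> quat \<Rightarrow> quat option" where
  "inv_point p m = (if m = 0 then None else Some (p + inverse m))"

text \<open>
  A circle through \<open>p\<close> is the image of a line under inversion at \<open>p\<close>; the image of infinity,
  \<open>p\<close> itself, has to be added.
\<close>

definition inv_line :: "quat \<Rightarrow> quat \<Rightarrow> quat \<Rightarrow> quat option set" where
  "inv_line p a d = insert (Some p) (inv_point p ` range (\<lambda>k::real. a + k *\<^sub>R d))"

lemma inv_point_inverse_diff: "x \<noteq> p \<Longrightarrow> inv_point p (inverse (x - p)) = Some x"
  by (simp add: inv_point_def)

lemma inv_point_inject [simp]: "inv_point p m = inv_point p m' \<longleftrightarrow> m = m'"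
  by (auto simp: inv_point_def)

lemma inv_line_reparam:
  assumes "s \<noteq> 0"
  shows "inv_line p (a + t *\<^sub>R d) (s *\<^sub>R d) = inv_line p a d"
proof -
  have "a + k *\<^sub>R d \<in> range (\<lambda>k. a + t *\<^sub>R d + k *\<^sub>R s *\<^sub>R d)" for k
    using assms by (intro range_eqI[of _ _ "(k - t) / s"]) (simp add: add.assoc flip: scaleR_add_left)
  moreover have "a + t *\<^sub>R d + k *\<^sub>R s *\<^sub>R d \<in> range (\<lambda>k. a + k *\<^sub>R d)" for k
    by (intro range_eqI[of _ _ "t + k * s"]) (simp add: algebra_simps)
  ultimately have "range (\<lambda>k. a + t *\<^sub>R d + k *\<^sub>R s *\<^sub>R d) = range (\<lambda>k. a + k *\<^sub>R d)"
    by (intro equalityI image_subsetI)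
  then show ?thesis by (simp add: inv_line_def)
qed

text \<open>Inverses of multiples of an imaginary \<open>d\<close> are again multiples of
  \<open>d\<close>, so a line through \<open>p\<close> corresponds to a line through
  \<open>0\<close>; \<open>p\<close> and infinity exchange roles.\<close>

lemma line_eq_inv_line:
  assumes "d \<in> ImH" "d \<noteq> 0"
  shows "insert None (Some ` range (\<lambda>k::real. p + k *\<^sub>R d)) = inv_line p 0 d"
proof -
  \<comment> \<open>The parameter after inversion. Division by zero gives \<open>j 0 = 0\<close>, so
    \<open>inv\<close> and \<open>inv'\<close> include \<open>k = 0\<close>.\<close>
  define j where "j k = - 1 / (k * inner d d)" for k
  have inv: "inverse (k *\<^sub>R d) = j k *\<^sub>R d" for k
    using assms by (simp add: ImH_inverse_eq j_def)
  have inv': "inverse (j k *\<^sub>R d) = k *\<^sub>R d" for k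
    unfolding inv[symmetric] by (rule inverse_inverse_eq)
  have j: "j k = 0 \<longleftrightarrow> k = 0" for k
    using assms by (simp add: j_def)
  show ?thesis
  proof (intro set_eqI iffI)
    fix z assume "z \<in> insert None (Some ` range (\<lambda>k::real. p + k *\<^sub>R d))"
    then consider "z = None" | k where "z = Some (p + k *\<^sub>R d)" by blast
    then show "z \<in> inv_line p 0 d"
    proof cases
      case 1
      then have "z = inv_point p (0 + 0 *\<^sub>R d)" by (simp add: inv_point_def)
      then show ?thesis unfolding inv_line_def by blast
    next
      case 2
      show ?thesis
      proof (cases "k = 0")
        case False
        then have "z = inv_point p (0 + j k *\<^sub>R d)"
          using 2 assms j[of k] inv'[of k] by (simp only: inv_point_def) simp
        then show ?thesis unfolding inv_line_def by blast
      qed (simp add: 2 inv_line_def)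
    qed
  next
    fix z assume "z \<in> inv_line p 0 d"
    then consider "z = Some (p + 0 *\<^sub>R d)" | k where "z = inv_point p (k *\<^sub>R d)"
      unfolding inv_line_def by auto
    then show "z \<in> insert None (Some ` range (\<lambda>k::real. p + k *\<^sub>R d))"
    proof cases
      case 1
      then show ?thesis by blast
    next
      case 2
      then have "z = None \<or> z = Some (p + j k *\<^sub>R d)" unfolding inv_point_def inv by simp
      then show ?thesis by blast
    qed
  qed
qed

text \<open>For \<open>x = p + y\<close> the circle is given by \<open>inner n y = 0\<close> and
  \<open>inner y y = 2 * inner c y\<close>. Away from \<open>y = 0\<close>, the second equation
  becomes linear in \<open>m = inverse y\<close>, namely \<open>inner c m = - 1 / 2\<close>, so
  \<open>m\<close> runs over the line through \<open>inverse (2 *\<^sub>R c)\<close> orthogonal to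
  \<open>n\<close> and \<open>c\<close>.\<close>

lemma circle_eq_inv_line:
  assumes "p \<in> ImH" "n \<in> ImH" "c \<in> ImH" "n \<noteq> 0" "c \<noteq> 0" "inner n c = 0"
  shows "Some ` {x \<in> ImH. inner n (x - (p + c)) = 0 \<and> dist x (p + c) = norm c}
    = inv_line p (inverse (2 *\<^sub>R c)) (n * c)" (is "Some ` ?C = ?L")
proof -
  have nc: "n * c \<in> ImH" "inner n (n * c) = 0" "inner c (n * c) = 0"
    using assms ImH_mult_orthogonal inner_mult_orthogonal by auto
  have a: "inverse (2 *\<^sub>R c) = (- 1 / (2 * inner c c)) *\<^sub>R c"
    using assms by (simp add: ImH_inverse_eq del: inverse_scaleR_distrib)
  have mem: "p + y \<in> ?C \<longleftrightarrow> y \<in> ImH \<and> inner n y = 0 \<and> inner y y = 2 * inner c y" for y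
  proof -
    have "dist (p + y) (p + c) = norm c \<longleftrightarrow> inner (y - c) (y - c) = inner c c"
      by (simp add: dist_norm norm_eq_sqrt_inner)
    moreover have "p + y \<in> ImH \<longleftrightarrow> y \<in> ImH" using assms by (simp add: ImH_def)
    moreover have "inner n (p + y - (p + c)) = inner n y"
      using assms by (simp add: inner_diff_right)
    moreover have "inner (y - c) (y - c) = inner c c \<longleftrightarrow> inner y y = 2 * inner c y"
      by (auto simp: inner_diff_left inner_diff_right inner_commute)
    ultimately show ?thesis by simp
  qed
  have "Some x \<in> ?L" if "x \<in> ?C" for x
  proof (cases "x = p")
    case False
    define y where "y = x - p"
    have y: "y \<noteq> 0" "y \<in> ImH" "inner n y = 0" "inner y y = 2 * inner c y"
      using False mem[of y] that by (auto simp: y_def)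
    define w where "w = inverse y - inverse (2 *\<^sub>R c)"
    have iy: "inverse y = (- 1 / inner y y) *\<^sub>R y"
      using y by (simp add: ImH_inverse_eq)
    have "inner y y \<noteq> 0" using y(1) by simp
    then have "inner c y \<noteq> 0" using y(4) by (metis mult_zero_right)
    have "w \<in> ImH" using y assms by (simp add: w_def)
    moreover have "inner n w = 0" "inner c w = 0"
      using y(1-3) assms \<open>inner c y \<noteq> 0\<close>
      by (simp_all add: w_def iy a inner_diff_right y(4))
    ultimately obtain k where "w = k *\<^sub>R (n * c)"
      using ImH_orthogonal_parallel assms by blast
    then have "inverse y = inverse (2 *\<^sub>R c) + k *\<^sub>R (n * c)"
      by (simp add: w_def algebra_simps)
    moreover have "Some x = inv_point p (inverse y)"
      using False by (simp add: y_def inv_point_inverse_diff)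
    ultimately show ?thesis unfolding inv_line_def by blast
  qed (simp add: inv_line_def)
  moreover have "inv_point p (inverse (2 *\<^sub>R c) + k *\<^sub>R (n * c)) \<in> Some ` ?C" for k
  proof -
    define m where "m = inverse (2 *\<^sub>R c) + k *\<^sub>R (n * c)"
    have m: "m \<in> ImH" "inner n m = 0" "inner c m = - 1 / 2"
      using assms nc by (simp_all add: m_def a inner_diff_right)
    then have "m \<noteq> 0" by auto
    then have "inner m m \<noteq> 0" by simp
    have im: "inverse m = (- 1 / inner m m) *\<^sub>R m"
      using m by (simp add: ImH_inverse_eq)
    have "p + inverse m \<in> ?C"
      unfolding mem using m \<open>inner m m \<noteq> 0\<close> by (simp add: im)
    then show ?thesis using \<open>m \<noteq> 0\<close> by (simp add: inv_point_def flip: m_def)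
  qed
  moreover have "Some p \<in> Some ` ?C" using mem[of 0] by simp
  ultimately show ?thesis unfolding inv_line_def by blast
qed

lemma is_circle_imp_inv_line:
  assumes "is_circle C" "Some p \<in> C"
  shows "\<exists>a d. C = inv_line p a d"
  using assms(1) unfolding is_circle_def
proof (elim disjE bexE exE conjE)
  fix c n r assume h: "c \<in> ImH" "n \<in> ImH" "r > 0" "n \<noteq> 0"
    and C: "C = Some ` {x \<in> ImH. inner n (x - c) = 0 \<and> dist x c = r}"
  have p: "p \<in> ImH" "inner n (p - c) = 0" "dist p c = r" using assms(2) C by auto
  have r: "r = norm (c - p)" using p(3) by (simp add: dist_norm norm_minus_commute)
  have "c - p \<noteq> 0" using r h by auto
  moreover have "inner n (c - p) = 0" using p(2) by (simp add: inner_diff_right)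
  ultimately show ?thesis
    using circle_eq_inv_line[of p n "c - p"] h p(1) unfolding C r by auto
next
  fix a d assume h: "a \<in> ImH" "d \<in> ImH" "d \<noteq> 0"
    and C: "C = insert None (Some ` range (\<lambda>k::real. a + k *\<^sub>R d))"
  obtain t where p: "p = a + t *\<^sub>R d" using assms(2) C by auto
  have "a + k *\<^sub>R d \<in> range (\<lambda>k. p + k *\<^sub>R d)" for k
    by (intro range_eqI[of _ _ "k - t"]) (simp add: p algebra_simps)
  moreover have "p + k *\<^sub>R d \<in> range (\<lambda>k. a + k *\<^sub>R d)" for k
    by (intro range_eqI[of _ _ "t + k"]) (simp add: p algebra_simps)
  ultimately have "range (\<lambda>k. a + k *\<^sub>R d) = range (\<lambda>k. p + k *\<^sub>R d)"
    by (intro equalityI image_subsetI)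
  then have "C = inv_line p 0 d" using line_eq_inv_line[OF h(2,3), of p] by (simp only: C)
  then show ?thesis by blast
qed

lemma is_circle_inv_line:
  assumes "p \<in> ImH" "a \<in> ImH" "d \<in> ImH" "d \<noteq> 0"
  shows "is_circle (inv_line p a d)"
proof -
  \<comment> \<open>The point of the line nearest to \<open>0\<close>. If it is \<open>0\<close>,
    the image is a line through \<open>p\<close>; otherwise it is the coordinate of the point
    opposite to \<open>p\<close> on a circle with centre \<open>p + c\<close>.\<close>
  define b where "b = a + (- inner a d / inner d d) *\<^sub>R d"
  have b: "b \<in> ImH" "inner b d = 0"
    using assms by (simp_all add: b_def inner_diff_left)
  have L: "inv_line p a d = inv_line p b d"
    using inv_line_reparam[of 1 p a "- inner a d / inner d d" d] by (simp add: b_def)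
  show ?thesis
  proof (cases "b = 0")
    case True
    then have "inv_line p a d = insert None (Some ` range (\<lambda>k::real. p + k *\<^sub>R d))"
      using line_eq_inv_line[of d p] assms L by simp
    then show ?thesis
      unfolding is_circle_def using assms by blast
  next
    case False
    define c where "c = inverse (2 *\<^sub>R b)"
    have c: "c = (- 1 / (2 * inner b b)) *\<^sub>R b"
      using b by (simp add: c_def ImH_inverse_eq del: inverse_scaleR_distrib)
    define n where "n = b * d"
    have n: "n \<in> ImH" "inner n b = 0" "n \<noteq> 0"
      using b assms False ImH_mult_orthogonal inner_mult_orthogonal
      by (auto simp: n_def inner_commute)
    have cI: "c \<in> ImH" "c \<noteq> 0" "inner n c = 0" using b False n by (auto simp: c)
    have "inverse (2 *\<^sub>R c) = b"
      by (simp add: c_def inverse_scaleR_distrib del: scaleR_conv_of_real)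
    moreover have "n * c = (- 1 / 2) *\<^sub>R d"
    proof -
      have "d * b = - (b * d)"
        using ImH_anticomm[of d b] b assms by (simp add: inner_commute eq_neg_iff_add_eq_0)
      then have "b * d * b = - (b * b) * d" by (simp add: mult.assoc)
      also have "\<dots> = inner b b *\<^sub>R d" using ImH_mult_self[OF b(1)] by simp
      finally show ?thesis using False by (simp add: n_def c)
    qed
    ultimately have "Some ` {x \<in> ImH. inner n (x - (p + c)) = 0 \<and> dist x (p + c) = norm c}
        = inv_line p (b + 0 *\<^sub>R d) ((- 1 / 2) *\<^sub>R d)"
      using circle_eq_inv_line[of p n c] assms n cI by simp
    also have "\<dots> = inv_line p a d"
      unfolding L by (rule inv_line_reparam) simp
    finally have C: "inv_line p a d
        = Some ` {x \<in> ImH. inner n (x - (p + c)) = 0 \<and> dist x (p + c) = norm c}" ..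
    have "p + c \<in> ImH" "norm c > 0" using assms cI by simp_all
    with C n show ?thesis unfolding is_circle_def by blast
  qed
qed

text \<open>Inversion at \<open>p\<close> reduces uniqueness of the circle through three points to
  that of the line through two, the coordinates of \<open>q\<close> and \<open>r\<close>.\<close>

lemma is_circle_eq_inv_line:
  assumes "is_circle C" "{Some p, Some q, Some r} \<subseteq> C" "distinct [p, q, r]"
  shows "C = inv_line p (inverse (q - p)) (inverse (r - p) - inverse (q - p))"
proof -
  obtain a d where C: "C = inv_line p a d" using is_circle_imp_inv_line assms by blast
  have "\<exists>k. inverse (x - p) = a + k *\<^sub>R d" if "Some x \<in> C" "x \<noteq> p" for x
    using that inv_point_inverse_diff[of x p] unfolding C inv_line_def by auto
  then obtain k l where k: "inverse (q - p) = a + k *\<^sub>R d" and l: "inverse (r - p) = a + l *\<^sub>R d"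
    using assms by (metis distinct_length_2_or_more insert_subset)
  have "k \<noteq> l"
  proof
    assume "k = l"
    then have "inverse (q - p) = inverse (r - p)" using k l by simp
    then show False using assms by simp
  qed
  moreover have "inverse (r - p) - inverse (q - p) = (l - k) *\<^sub>R d"
    by (simp add: k l algebra_simps)
  ultimately show ?thesis using inv_line_reparam[of "l - k" p a k d] C k by simp
qed

lemma circle_through_unique:
  assumes "is_circle C" "{Some p, Some q, Some r} \<subseteq> C" "distinct [p, q, r]"
  shows "circle_through (Some p) (Some q) (Some r) = C"
  unfolding circle_through_def
proof (rule the_equality)
  fix D assume "is_circle D \<and> {Some p, Some q, Some r} \<subseteq> D"
  then have "D = inv_line p (inverse (q - p)) (inverse (r - p) - inverse (q - p))"
    using is_circle_eq_inv_line assms(3) by blast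
  then show "D = C" using is_circle_eq_inv_line[OF assms] by simp
qed (use assms in simp)

lemma circle_through_eq:
  assumes "{p, q, r} \<subseteq> ImH" "distinct [p, q, r]"
  shows "circle_through (Some p) (Some q) (Some r)
      = inv_line p (inverse (q - p)) (inverse (r - p) - inverse (q - p))" (is "_ = ?L")
    and "is_circle (circle_through (Some p) (Some q) (Some r))"
    and "{Some p, Some q, Some r} \<subseteq> circle_through (Some p) (Some q) (Some r)"
proof -
  have 1: "is_circle ?L" using assms by (intro is_circle_inv_line) auto
  have 2: "{Some p, Some q, Some r} \<subseteq> ?L"
  proof -
    let ?f = "\<lambda>k::real. inverse (q - p) + k *\<^sub>R (inverse (r - p) - inverse (q - p))"
    have "Some q = inv_point p (?f 0)" "Some r = inv_point p (?f 1)"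
      using assms inv_point_inverse_diff[of q p] inv_point_inverse_diff[of r p] by auto
    then show ?thesis unfolding inv_line_def by blast
  qed
  show "circle_through (Some p) (Some q) (Some r) = ?L"
    using circle_through_unique 1 2 assms by blast
  with 1 2 show "is_circle (circle_through (Some p) (Some q) (Some r))"
    "{Some p, Some q, Some r} \<subseteq> circle_through (Some p) (Some q) (Some r)" by auto
qed

section \<open>Change of the centre of inversion\<close>

text \<open>Needed for circles that avoid \<open>p\<close>: they become lines only after inversion
  at one of their own points. The new coordinate \<open>inverse (inverse m - inverse q)\<close> is
  rewritten as an affine function of \<open>inverse (m - q)\<close>, which also sends
  \<open>m = 0\<close>, that is infinity, to \<open>0\<close>.\<close>

lemma inv_point_change_base:
  assumes "q \<noteq> 0" "m \<noteq> q"
  shows "inv_point p m = inv_point (p + inverse q) (- q - q * inverse (m - q) * q)"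
proof (cases "m = 0")
  case True
  then show ?thesis using assms by (simp add: inv_point_def nonzero_inverse_minus_eq)
next
  case False
  have "inverse m - inverse q = - (inverse m * (m - q) * inverse q)"
    using False assms(1) by (rule inverse_diff_inverse)
  then have "inverse (inverse m - inverse q) = - (q * inverse (m - q) * m)"
    using False assms by (simp add: nonzero_inverse_mult_distrib nonzero_inverse_minus_eq mult.assoc)
  also have "\<dots> = - (q * inverse (m - q) * ((m - q) + q))" by simp
  also have "\<dots> = - q - q * inverse (m - q) * q"
    using assms by (simp only: distrib_left) (simp add: mult.assoc)
  finally have "inverse (inverse m - inverse q) = - q - q * inverse (m - q) * q" .
  moreover have "inv_point p m = Some (p + inverse m)" using False by (simp add: inv_point_def)
  moreover have "p + inverse m \<noteq> p + inverse q" using assms by simp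
  ultimately show ?thesis
    using inv_point_inverse_diff[of "p + inverse m" "p + inverse q"]
    by (simp only: add_diff_cancel_left not_False_eq_True simp_thms)
qed

text \<open>The coordinate \<open>h z\<close> relative to \<open>p + inverse a\<close> is affine in
  \<open>inverse (z - a)\<close>. So the relation assumed for \<open>m\<close>, which puts it on the
  circle or line through \<open>a\<close>, \<open>b\<close>, \<open>c\<close>, carries over to the
  images.\<close>

lemma inv_point_mem_circle_through:
  assumes "p \<in> ImH" "{a, b, c} \<subseteq> ImH" "a \<noteq> 0" "b \<noteq> 0" "c \<noteq> 0" "distinct [a, b, c]"
    and m: "m \<noteq> a" "inverse (m - a) = (1 - k) *\<^sub>R inverse (b - a) + k *\<^sub>R inverse (c - a)"
  shows "inv_point p m
    \<in> circle_through (Some (p + inverse a)) (Some (p + inverse b)) (Some (p + inverse c))"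
proof -
  define h where "h m = - a - a * inverse (m - a) * a" for m
  have inv: "inverse (p + inverse z - (p + inverse a)) = h z" if "z \<noteq> 0" "z \<noteq> a" for z
  proof -
    have "inv_point (p + inverse a) (inverse (p + inverse z - (p + inverse a))) = inv_point (p + inverse a) (h z)"
    proof -
      have "p + inverse z \<noteq> p + inverse a" using that by simp
      then have "inv_point (p + inverse a) (inverse (p + inverse z - (p + inverse a)))
          = Some (p + inverse z)"
        by (rule inv_point_inverse_diff)
      also have "\<dots> = inv_point p z" using that by (simp add: inv_point_def)
      also have "\<dots> = inv_point (p + inverse a) (h z)"
        unfolding h_def using \<open>a \<noteq> 0\<close> that(2) by (rule inv_point_change_base)
      finally show ?thesis .
    qed
    then show ?thesis by (simp only: inv_point_inject)
  qed
  have "h m = h b + k *\<^sub>R (h c - h b)"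
    unfolding h_def m(2) by (simp add: algebra_simps)
  moreover have "circle_through (Some (p + inverse a)) (Some (p + inverse b)) (Some (p + inverse c))
      = inv_line (p + inverse a) (h b) (h c - h b)"
  proof -
    have "{p + inverse a, p + inverse b, p + inverse c} \<subseteq> ImH"
      "distinct [p + inverse a, p + inverse b, p + inverse c]"
      using assms(1-6) by auto
    moreover have "inverse (p + inverse b - (p + inverse a)) = h b"
      "inverse (p + inverse c - (p + inverse a)) = h c"
      using assms inv[of b] inv[of c] by auto
    ultimately show ?thesis using circle_through_eq(1) by metis
  qed
  moreover have "inv_point p m = inv_point (p + inverse a) (h m)"
    using inv_point_change_base assms m by (simp add: h_def)
  ultimately show ?thesis unfolding inv_line_def by (simp only:) blast
qed

section \<open>A quaternionic formula for the Miquel point of a triangle\<close>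

text \<open>
  The points \<open>g, f, e\<close> are on the sides \<open>ab, ac, bc\<close> of the triangle \<open>abc\<close>. For
  \<open>q\<^sub>1, q\<^sub>2, q\<^sub>4\<close> and \<open>q\<^sub>3, q\<^sub>5, q\<^sub>6\<close>, \<open>miquel_num\<close> is \<open>A'\<close> and \<open>miquel_den\<close> is
  \<open>A' - B'\<close>: reversing the product of coplanar vectors \<open>B'\<close> gives minus the numerator
  with \<open>a\<close> and \<open>b\<close> exchanged.
\<close>

definition miquel_num :: "quat \<Rightarrow> quat \<Rightarrow> quat \<Rightarrow> quat \<Rightarrow> quat \<Rightarrow> quat" where
  "miquel_num a b c g f = (c - a) * (g - f) * (a - b)"

definition miquel_den :: "quat \<Rightarrow> quat \<Rightarrow> quat \<Rightarrow> quat \<Rightarrow> quat \<Rightarrow> quat \<Rightarrow> quat" where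
  "miquel_den a b c g f e = miquel_num a b c g f + miquel_num b a c g e"

definition miquel_pt :: "quat \<Rightarrow> quat \<Rightarrow> quat \<Rightarrow> quat \<Rightarrow> quat \<Rightarrow> quat \<Rightarrow> quat" where
  "miquel_pt a b c g f e =
     a + miquel_num a b c g f * inverse (miquel_den a b c g f e) * (b - a)"

text \<open>\<open>u * u\<close> and \<open>w * w\<close> are real, hence central, and one of them
  occurs in each term of the expansion.\<close>

lemma coplanar_mult_reverse:
  assumes "u \<in> ImH" "w \<in> ImH"
  shows "u * (r *\<^sub>R u + s *\<^sub>R w) * w = w * (r *\<^sub>R u + s *\<^sub>R w) * u"
proof -
  have "u * (r *\<^sub>R u + s *\<^sub>R w) * w = r *\<^sub>R (u * u * w) + s *\<^sub>R (u * (w * w))"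
    "w * (r *\<^sub>R u + s *\<^sub>R w) * u = r *\<^sub>R (w * (u * u)) + s *\<^sub>R (w * w * u)"
    by (simp_all add: algebra_simps)
  then show ?thesis using ImH_mult_self assms by simp
qed

text \<open>In each term of the expanded product two adjacent factors are equal up to a real factor,
  and their product is real; what remains is a multiple of one side.\<close>

lemma miquel_num_eq:
  assumes "a \<in> ImH" "b \<in> ImH" "c \<in> ImH"
  shows "miquel_num a b c (a + l *\<^sub>R (b - a)) (a + m *\<^sub>R (c - a))
    = (l * inner (b - a) (b - a)) *\<^sub>R (c - a) - (m * inner (c - a) (c - a)) *\<^sub>R (b - a)"
proof -
  define x y where "x = b - a" and "y = c - a"
  have I: "x \<in> ImH" "y \<in> ImH" using assms by (simp_all add: x_def y_def)
  have "miquel_num a b c (a + l *\<^sub>R (b - a)) (a + m *\<^sub>R (c - a)) = y * (l *\<^sub>R x - m *\<^sub>R y) * (- x)"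
    by (simp add: miquel_num_def x_def y_def)
  also have "\<dots> = m *\<^sub>R (y * y * x) - l *\<^sub>R (y * (x * x))"
    by (simp add: algebra_simps)
  finally show ?thesis
    using ImH_mult_self[OF I(1)] ImH_mult_self[OF I(2)] by (simp add: x_def y_def)
qed

text \<open>A locale lets the relabellings \<open>swap_ab\<close> and \<open>swap_bc\<close>, which
  generate all permutations of the vertices, transport each result to the other corners.
  \<open>indep\<close> says that the triangle is not degenerate.\<close>

locale side_points =
  fixes a b c g f e :: quat and l m n :: real
  assumes ImH: "a \<in> ImH" "b \<in> ImH" "c \<in> ImH"
    and indep: "b \<noteq> a" "\<And>k. c - a \<noteq> k *\<^sub>R (b - a)"
    and g: "g = a + l *\<^sub>R (b - a)"
    and f: "f = a + m *\<^sub>R (c - a)"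
    and e: "e = b + n *\<^sub>R (c - b)"
begin

lemma swap_ab: "side_points b a c g e f (1 - l) n m"
proof
  show "c - b \<noteq> k *\<^sub>R (a - b)" for k
  proof
    assume "c - b = k *\<^sub>R (a - b)"
    then have "c - a = (1 - k) *\<^sub>R (b - a)" by (simp add: algebra_simps)
    then show False using indep by blast
  qed
qed (use ImH indep g f e in \<open>auto simp: algebra_simps\<close>)

lemma swap_bc: "side_points a c b f g e m l (1 - n)"
proof
  show "c \<noteq> a" using indep(2)[of 0] by auto
  show "b - a \<noteq> k *\<^sub>R (c - a)" for k
  proof
    assume k: "b - a = k *\<^sub>R (c - a)"
    then have "k \<noteq> 0" using indep(1) by auto
    then have "c - a = (1 / k) *\<^sub>R (b - a)" by (simp add: k)
    then show False using indep by blast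
  qed
qed (use ImH g f e in \<open>auto simp: algebra_simps\<close>)

text \<open>The component of \<open>miquel_den\<close> along \<open>b - a\<close> in the basis
  \<open>c - a\<close>, \<open>b - a\<close>.\<close>

definition "den_coeff = n * inner (c - b) (c - b) - m * inner (c - a) (c - a)
  - (1 - l) * inner (b - a) (b - a)"

lemma num_eq:
  "miquel_num a b c g f = (l * inner (b - a) (b - a)) *\<^sub>R (c - a) - (m * inner (c - a) (c - a)) *\<^sub>R (b - a)"
  unfolding g f using miquel_num_eq ImH by blast

text \<open>The two contributions along \<open>c - a\<close> carry the weights \<open>l\<close> and
  \<open>1 - l\<close>, so \<open>l\<close> cancels there. The positive coefficient that remains
  makes the denominator nonzero.\<close>

lemma den_eq:
  "miquel_den a b c g f e = inner (b - a) (b - a) *\<^sub>R (c - a) + den_coeff *\<^sub>R (b - a)"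
proof -
  have *: "c - b = (c - a) - (b - a)" "a - b = - (b - a)" by simp_all
  show ?thesis
    unfolding miquel_den_def num_eq side_points.num_eq[OF swap_ab] den_coeff_def
    by (simp only: * inner_minus_left inner_minus_right) (simp add: algebra_simps)
qed

lemma combination_nonzero:
  assumes "s \<noteq> 0"
  shows "s *\<^sub>R (c - a) + t *\<^sub>R (b - a) \<noteq> 0"
proof
  assume "s *\<^sub>R (c - a) + t *\<^sub>R (b - a) = 0"
  then have "s *\<^sub>R (c - a) = s *\<^sub>R ((- t / s) *\<^sub>R (b - a))"
    using assms by (simp add: add_eq_0_iff2)
  then have "c - a = (- t / s) *\<^sub>R (b - a)"
    using assms unfolding scaleR_cancel_left by blast
  then show False using indep(2) by blast
qed

lemma den_nonzero: "miquel_den a b c g f e \<noteq> 0"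
  unfolding den_eq using indep by (intro combination_nonzero) simp

lemma num_nonzero:
  assumes "l \<noteq> 0"
  shows "miquel_num a b c g f \<noteq> 0"
  using combination_nonzero[of "l * inner (b - a) (b - a)" "- (m * inner (c - a) (c - a))"] indep assms
  by (simp add: num_eq)

lemma num_swap: "miquel_num a c b f g = - miquel_num a b c g f"
  unfolding num_eq side_points.num_eq[OF swap_bc] by simp

lemma num_other: "miquel_num b a c g e = - ((a - b) * (e - g) * (b - c))"
proof -
  have I: "b - a \<in> ImH" "c - b \<in> ImH" using ImH by simp_all
  have "g - e = (l - 1) *\<^sub>R (b - a) + (- n) *\<^sub>R (c - b)" by (simp add: g e algebra_simps)
  then have "miquel_num b a c g e = (b - a) * (g - e) * (c - b)"
    using coplanar_mult_reverse[OF I, of "l - 1" "- n"] by (simp add: miquel_num_def)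
  then show ?thesis by (simp add: algebra_simps)
qed

text \<open>The two numerators add up to the common denominator, so their quotients by it add up to
  \<open>1\<close> and split \<open>b - a\<close> in complementary ways.\<close>

lemma pt_swap_ab: "miquel_pt a b c g f e = miquel_pt b a c g e f"
proof -
  define A B where "A = miquel_num a b c g f" and "B = miquel_num b a c g e"
  have "A + B \<noteq> 0" using den_nonzero by (simp add: A_def B_def miquel_den_def)
  then have "(A + B) * inverse (A + B) * (b - a) = b - a" by simp
  then have "A * inverse (A + B) * (b - a) = (b - a) - B * inverse (A + B) * (b - a)"
    by (simp add: algebra_simps)
  also have "\<dots> = (b - a) + B * inverse (A + B) * (a - b)"
    by (simp add: algebra_simps)
  finally show ?thesis
    by (simp add: miquel_pt_def miquel_den_def A_def B_def add.commute[of "miquel_num b a c g e"])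
qed

text \<open>As the numerators are opposite, it suffices that
  \<open>inverse x * D + inverse y * D' = 0\<close>. In this sum the products of \<open>x\<close>
  and \<open>y\<close> form their anticommutator, which is real and cancels against
  \<open>\<kappa> + \<kappa>'\<close>.\<close>

lemma pt_swap_bc: "miquel_pt a b c g f e = miquel_pt a c b f g e"
proof -
  define x y D D' \<kappa> \<kappa>' where "x = b - a" and "y = c - a"
    and "D = miquel_den a b c g f e" and "D' = miquel_den a c b f g e"
    and "\<kappa> = den_coeff" and "\<kappa>' = side_points.den_coeff a c b m l (1 - n)"
  have I: "x \<in> ImH" "y \<in> ImH" using ImH by (simp_all add: x_def y_def)
  have nz: "x \<noteq> 0" "y \<noteq> 0" "D \<noteq> 0" "D' \<noteq> 0"
    using indep indep(2)[of 0] den_nonzero side_points.den_nonzero[OF swap_bc]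
    by (auto simp: x_def y_def D_def D'_def)
  have D: "D = inner x x *\<^sub>R y + \<kappa> *\<^sub>R x" "D' = inner y y *\<^sub>R x + \<kappa>' *\<^sub>R y"
    unfolding D_def D'_def x_def y_def \<kappa>_def \<kappa>'_def den_eq side_points.den_eq[OF swap_bc] by simp_all
  have cb: "c - b = y - x" "b - c = x - y" by (simp_all add: x_def y_def)
  \<comment> \<open>The law of cosines: \<open>l\<close>, \<open>m\<close>, \<open>n\<close> cancel,
    leaving the square of the side \<open>bc\<close> minus those of \<open>ab\<close> and
    \<open>ac\<close>.\<close>
  have \<kappa>: "\<kappa> + \<kappa>' = - (2 * inner x y)"
    unfolding \<kappa>_def \<kappa>'_def den_coeff_def side_points.den_coeff_def[OF swap_bc]
      cb x_def[symmetric] y_def[symmetric]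
    by (simp add: inner_diff_left inner_diff_right algebra_simps inner_commute)
  have 1: "inverse x * D = \<kappa> *\<^sub>R 1 - x * y"
    unfolding D using nz by (simp add: distrib_left ImH_inverse_eq[OF I(1)] ImH_mult_self[OF I(1)])
  have 2: "inverse y * D' = \<kappa>' *\<^sub>R 1 - y * x"
    unfolding D using nz by (simp add: distrib_left ImH_inverse_eq[OF I(2)] ImH_mult_self[OF I(2)])
  have "inverse x * D + inverse y * D' = (\<kappa> + \<kappa>') *\<^sub>R 1 - (x * y + y * x)"
    unfolding 1 2 by (simp add: algebra_simps)
  also have "\<dots> = 0" unfolding \<kappa> ImH_anticomm[OF I] by simp
  finally have "inverse x * D = - (inverse y * D')" by (simp add: eq_neg_iff_add_eq_0)
  then have "inverse (inverse x * D) = inverse (- (inverse y * D'))" by simp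
  then have "inverse D * x = - (inverse D' * y)"
    using nz by (simp add: nonzero_inverse_mult_distrib nonzero_inverse_minus_eq)
  then show ?thesis
    unfolding miquel_pt_def num_swap x_def[symmetric] y_def[symmetric] D_def[symmetric] D'_def[symmetric]
    by (simp add: mult.assoc)
qed

text \<open>Seen from \<open>a\<close>, the circle through \<open>a\<close>, \<open>g\<close>,
  \<open>f\<close> is the line through \<open>inverse (g - a)\<close> and
  \<open>inverse (f - a)\<close>. For a point \<open>R\<close> of this line the claim amounts to
  \<open>x * R * A = D\<close>, an identity between real combinations of \<open>x\<close> and
  \<open>y\<close>: the \<open>y\<close> components always agree, and the \<open>x\<close>
  components determine \<open>k\<close>.\<close>

lemma inverse_pt_diff:
  assumes "l \<noteq> 0" "m \<noteq> 0"
  shows "miquel_pt a b c g f e \<noteq> a"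
    and "\<exists>k. inverse (miquel_pt a b c g f e - a)
      = (1 - k) *\<^sub>R inverse (g - a) + k *\<^sub>R inverse (f - a)"
proof -
  define x y A D \<kappa> where "x = b - a" and "y = c - a"
    and "A = miquel_num a b c g f" and "D = miquel_den a b c g f e" and "\<kappa> = den_coeff"
  have I: "x \<in> ImH" "y \<in> ImH" using ImH by (simp_all add: x_def y_def)
  have nz: "x \<noteq> 0" "y \<noteq> 0" "D \<noteq> 0" "A \<noteq> 0"
    using indep indep(2)[of 0] den_nonzero num_nonzero assms
    by (auto simp: x_def y_def D_def A_def)
  have pt: "miquel_pt a b c g f e - a = A * inverse D * x"
    by (simp add: miquel_pt_def A_def D_def x_def)
  then show "miquel_pt a b c g f e \<noteq> a" using nz by auto
  have A: "A = (l * inner x x) *\<^sub>R y - (m * inner y y) *\<^sub>R x"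
    unfolding A_def x_def y_def by (rule num_eq)
  have D: "D = inner x x *\<^sub>R y + \<kappa> *\<^sub>R x"
    unfolding D_def x_def y_def \<kappa>_def by (rule den_eq)
  \<comment> \<open>The squared distance between \<open>g\<close> and \<open>f\<close>.\<close>
  define N where "N = m\<^sup>2 * inner y y + l\<^sup>2 * inner x x - 2 * l * m * inner x y"
  have "N = inner (m *\<^sub>R y - l *\<^sub>R x) (m *\<^sub>R y - l *\<^sub>R x)"
    by (simp add: N_def inner_diff_left inner_diff_right inner_commute power2_eq_square)
  moreover have "m *\<^sub>R y - l *\<^sub>R x \<noteq> 0"
    using combination_nonzero[of m "- l"] assms by (simp add: x_def y_def)
  ultimately have N: "N \<noteq> 0" by simp
  \<comment> \<open>The solution of the equation between the \<open>x\<close> components,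
    \<open>(k * N - m\<^sup>2 * inner y y) / (l * m) = \<kappa>\<close>.\<close>
  define k where "k = m * (l * \<kappa> + m * inner y y) / N"
  have kN: "k * N = m * (l * \<kappa> + m * inner y y)" using N by (simp add: k_def)
  have xyx: "x * y * x = inner x x *\<^sub>R y - (2 * inner x y) *\<^sub>R x"
  proof -
    have "x * y * x = (x * y + y * x) * x - y * (x * x)" by (simp add: algebra_simps)
    then show ?thesis unfolding ImH_anticomm[OF I] ImH_mult_self[OF I(1)] by simp
  qed
  have xyA: "x * y * A = (m * inner y y * (2 * inner x y) - l * inner x x * inner y y) *\<^sub>R x
      - (m * inner x x * inner y y) *\<^sub>R y"
  proof -
    have "x * y * A = (l * inner x x) *\<^sub>R (x * (y * y)) - (m * inner y y) *\<^sub>R (x * y * x)"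
      unfolding A by (simp add: right_diff_distrib mult.assoc)
    then show ?thesis unfolding xyx ImH_mult_self[OF I(2)] by (simp add: algebra_simps)
  qed
  define R where "R = (1 - k) *\<^sub>R inverse (l *\<^sub>R x) + k *\<^sub>R inverse (m *\<^sub>R y)"
  have "x * R = ((1 - k) / l) *\<^sub>R 1 - (k / (m * inner y y)) *\<^sub>R (x * y)"
    unfolding R_def using nz assms
    by (simp add: distrib_left right_diff_distrib inverse_scaleR_distrib ImH_inverse_eq[OF I(2)] divide_inverse)
  then have "x * R * A = ((1 - k) / l) *\<^sub>R A - (k / (m * inner y y)) *\<^sub>R (x * y * A)"
    by (simp add: left_diff_distrib)
  also have "\<dots> = inner x x *\<^sub>R y + (((1 - k) / l) * - (m * inner y y)
      - (k / (m * inner y y)) * (m * inner y y * (2 * inner x y) - l * inner x x * inner y y)) *\<^sub>R x"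
  proof -
    have "((1 - k) / l) * (l * inner x x) + (k / (m * inner y y)) * (m * inner x x * inner y y) = inner x x"
      using assms nz by (simp add: field_simps)
    moreover have "\<alpha> *\<^sub>R (r *\<^sub>R y - r' *\<^sub>R x) - \<beta> *\<^sub>R (s *\<^sub>R x - s' *\<^sub>R y)
      = (\<alpha> * r + \<beta> * s') *\<^sub>R y + (\<alpha> * - r' - \<beta> * s) *\<^sub>R x" for \<alpha> \<beta> r r' s s'
      by (simp add: algebra_simps)
    ultimately show ?thesis
      unfolding xyA unfolding A by (simp only:)
  qed
  also have "((1 - k) / l) * - (m * inner y y)
      - (k / (m * inner y y)) * (m * inner y y * (2 * inner x y) - l * inner x x * inner y y) = \<kappa>"
  proof -
    have "((1 - k) / l) * - (m * inner y y)
      - (k / (m * inner y y)) * (m * inner y y * (2 * inner x y) - l * inner x x * inner y y)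
      = (k * N - m\<^sup>2 * inner y y) / (l * m)"
      unfolding N_def using assms nz by (simp add: field_simps power2_eq_square)
    then show ?thesis unfolding kN using assms by (simp add: field_simps power2_eq_square)
  qed
  finally have "x * R * A = D" by (simp add: D)
  then have "inverse x * D * inverse A = R"
    using nz by (metis (no_types, opaque_lifting) left_inverse right_inverse mult.assoc mult_1_left mult_1_right)
  then have "inverse (A * inverse D * x) = R"
    using nz by (simp add: nonzero_inverse_mult_distrib mult.assoc)
  then show "\<exists>k. inverse (miquel_pt a b c g f e - a)
      = (1 - k) *\<^sub>R inverse (g - a) + k *\<^sub>R inverse (f - a)"
    unfolding pt R_def by (auto simp: g f x_def y_def)
qed

lemma inv_point_pt_mem_circle_through:
  assumes "p \<in> ImH" "a \<noteq> 0" "g \<noteq> 0" "f \<noteq> 0" "l \<noteq> 0" "m \<noteq> 0"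
  shows "inv_point p (miquel_pt a b c g f e)
    \<in> circle_through (Some (p + inverse a)) (Some (p + inverse g)) (Some (p + inverse f))"
proof -
  have "g - f \<noteq> 0"
    using combination_nonzero[of "- m" l] assms by (simp add: g f)
  moreover have "a \<noteq> g" using indep(1) assms by (simp add: g)
  moreover have "a \<noteq> f" using indep(2)[of 0] assms by (simp add: f)
  moreover have "g \<in> ImH" "f \<in> ImH" using ImH by (simp_all add: g f)
  ultimately show ?thesis
    using inverse_pt_diff[OF assms(5,6)] inv_point_mem_circle_through[of p a g f] ImH(1) assms by auto
qed

end

section \<open>Application to the corner points\<close>

lemma mem_circle_through_inv:
  assumes "{p, a, b} \<subseteq> ImH" "distinct [p, a, b]" "x \<noteq> p"
    and "Some x \<in> circle_through (Some p) (Some a) (Some b)"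
  shows "\<exists>k. inverse (x - p) = inverse (a - p) + k *\<^sub>R (inverse (b - p) - inverse (a - p))"
  using assms inv_point_inverse_diff[of x p] by (auto simp: circle_through_eq(1) inv_line_def)

theorem corollary4p4:
  fixes F :: "real \<Rightarrow> real \<Rightarrow> real \<Rightarrow> quat option"
    and p q :: "nat \<Rightarrow> quat"
    and v1 v2 v3 A' B' :: quat
  assumes "dc_cube F" and "corner_points F p"
    and "{p 0, p 1, p 2, p 4} \<subseteq> ImH"
    and "distinct [p 0, p 1, p 2]" and "distinct [p 0, p 1, p 4]" and "distinct [p 0, p 2, p 4]"
    and "Some (p 3) \<in> circle_through (Some (p 0)) (Some (p 1)) (Some (p 2))"
    and "Some (p 5) \<in> circle_through (Some (p 0)) (Some (p 1)) (Some (p 4))"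
    and "Some (p 6) \<in> circle_through (Some (p 0)) (Some (p 2)) (Some (p 4))"
    and "distinct [p 1, p 3, p 5]" and "distinct [p 2, p 3, p 6]" and "distinct [p 4, p 5, p 6]"
    and "is_miquel_point (p 1) (p 2) (p 3) (p 4) (p 5) (p 6) (p 7)"
    and "frame_at_p0 F v1 v2 v3"
    and "\<forall>i\<in>{1..7}. p i \<noteq> p 0 \<and> q i = inverse (p i - p 0)"
    and "A' = (q 4 - q 1) * (q 3 - q 5) * (q 1 - q 2)"
    and "B' = (q 1 - q 2) * (q 6 - q 3) * (q 2 - q 4)"
  shows "A' - B' \<noteq> 0 \<and>
    q 1 + A' * inverse (A' - B') * (q 2 - q 1) \<noteq> 0 \<and>
    p 7 = p 0 + inverse (q 1 + A' * inverse (A' - B') * (q 2 - q 1))"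
proof -
  have q_def: "q i = inverse (p i - p 0)" and p_neq: "p i \<noteq> p 0" if "i \<in> {1..7}" for i
    using assms(15) that by auto
  have q_neq: "q i \<noteq> 0" and p_eq: "p 0 + inverse (q i) = p i" if "i \<in> {1..7}" for i
    using q_def[OF that] p_neq[OF that] by simp_all
  have q_inj: "q i \<noteq> q j" if "i \<in> {1..7}" "j \<in> {1..7}" "p i \<noteq> p j" for i j
    using q_def that by simp
  have pI: "p 0 \<in> ImH" "p 1 \<in> ImH" "p 2 \<in> ImH" "p 4 \<in> ImH" using assms(3) by auto
  have qI: "q 1 \<in> ImH" "q 2 \<in> ImH" "q 4 \<in> ImH" using pI q_def by simp_all
  obtain l where q3: "q 3 = q 1 + l *\<^sub>R (q 2 - q 1)"
    using mem_circle_through_inv[of "p 0" "p 1" "p 2" "p 3"] pI assms(4,7) p_neq by (auto simp: q_def)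
  obtain m where q5: "q 5 = q 1 + m *\<^sub>R (q 4 - q 1)"
    using mem_circle_through_inv[of "p 0" "p 1" "p 4" "p 5"] pI assms(5,8) p_neq by (auto simp: q_def)
  obtain n where q6: "q 6 = q 2 + n *\<^sub>R (q 4 - q 2)"
    using mem_circle_through_inv[of "p 0" "p 2" "p 4" "p 6"] pI assms(6,9) p_neq by (auto simp: q_def)
  have indep: "q 4 - q 1 \<noteq> k *\<^sub>R (q 2 - q 1)" for k
  proof
    \<comment> \<open>Otherwise all the circles coincide, and their intersection is not a singleton.\<close>
    assume k: "q 4 - q 1 = k *\<^sub>R (q 2 - q 1)"
    define C where "C = circle_through (Some (p 0)) (Some (p 1)) (Some (p 2))"
    have C: "is_circle C" "Some (p 0) \<in> C" "Some (p 1) \<in> C" "Some (p 2) \<in> C" "Some (p 3) \<in> C"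
      using circle_through_eq(2,3)[of "p 0" "p 1" "p 2"] pI assms(4,7) by (auto simp: C_def)
    have "C = inv_line (p 0) (q 1) (q 2 - q 1)"
      unfolding C_def using circle_through_eq(1)[of "p 0" "p 1" "p 2"] pI assms(4) by (simp add: q_def)
    moreover have "Some (p 4) = inv_point (p 0) (q 1 + k *\<^sub>R (q 2 - q 1))"
    proof -
      have "q 1 + k *\<^sub>R (q 2 - q 1) = q 4" unfolding k[symmetric] by simp
      then show ?thesis using q_neq[of 4] p_eq[of 4] by (simp only: inv_point_def) simp
    qed
    ultimately have p4: "Some (p 4) \<in> C" unfolding inv_line_def by blast
    have p5: "Some (p 5) \<in> C"
      using assms(8) circle_through_unique[of C "p 0" "p 1" "p 4"] C p4 assms(5) by auto
    have p6: "Some (p 6) \<in> C"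
      using assms(9) circle_through_unique[of C "p 0" "p 2" "p 4"] C p4 assms(6) by auto
    have "circle_through (Some (p 1)) (Some (p 3)) (Some (p 5)) = C"
      "circle_through (Some (p 2)) (Some (p 3)) (Some (p 6)) = C"
      "circle_through (Some (p 4)) (Some (p 5)) (Some (p 6)) = C"
      using assms(10-12) C p4 p5 p6 by (simp_all add: circle_through_unique)
    then have "C = {Some (p 7)}" using assms(13) by (simp add: is_miquel_point_def)
    then show False using C assms(4) by auto
  qed
  interpret S: side_points "q 1" "q 2" "q 4" "q 3" "q 5" "q 6" l m n
    using qI q_inj[of 2 1] assms(4) indep q3 q5 q6 by unfold_locales auto
  \<comment> \<open>Each vertex takes the first place in turn, since membership is proved for the
    circle at the first vertex; \<open>S'\<close> links \<open>S\<close> to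
    \<open>S4\<close>.\<close>
  interpret S2: side_points "q 2" "q 1" "q 4" "q 3" "q 6" "q 5" "1 - l" n m
    by (rule S.swap_ab)
  interpret S': side_points "q 1" "q 4" "q 2" "q 5" "q 3" "q 6" m l "1 - n"
    by (rule S.swap_bc)
  interpret S4: side_points "q 4" "q 1" "q 2" "q 5" "q 6" "q 3" "1 - m" "1 - n" l
    by (rule S'.swap_ab)
  \<comment> \<open>Distinctness of the points defining the three circles keeps \<open>q 3\<close>,
    \<open>q 5\<close>, \<open>q 6\<close> off the vertices of the triangle.\<close>
  have nz: "l \<noteq> 0" "1 - l \<noteq> 0" "m \<noteq> 0" "1 - m \<noteq> 0" "n \<noteq> 0" "1 - n \<noteq> 0"
    using q_inj[of 3 1] q_inj[of 3 2] q_inj[of 5 1] q_inj[of 5 4] q_inj[of 6 2] q_inj[of 6 4]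
      assms(10-12) q3 q5 q6 by auto
  define M where "M = miquel_pt (q 1) (q 2) (q 4) (q 3) (q 5) (q 6)"
  have "inv_point (p 0) M \<in> circle_through (Some (p 1)) (Some (p 3)) (Some (p 5))"
    using S.inv_point_pt_mem_circle_through[of "p 0"] pI nz q_neq p_eq by (simp add: M_def)
  moreover have "inv_point (p 0) M \<in> circle_through (Some (p 2)) (Some (p 3)) (Some (p 6))"
    using S2.inv_point_pt_mem_circle_through[of "p 0"] pI nz q_neq p_eq S.pt_swap_ab by (simp add: M_def)
  moreover have "inv_point (p 0) M \<in> circle_through (Some (p 4)) (Some (p 5)) (Some (p 6))"
    using S4.inv_point_pt_mem_circle_through[of "p 0"] pI nz q_neq p_eq S.pt_swap_bc S'.pt_swap_ab
    by (simp add: M_def)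
  ultimately have "inv_point (p 0) M = Some (p 7)"
    using assms(13) unfolding is_miquel_point_def by blast
  \<comment> \<open>\<open>Some\<close> on the right excludes \<open>M = 0\<close>, which would mean
    infinity.\<close>
  then have M: "M \<noteq> 0" "p 7 = p 0 + inverse M"
    by (auto simp: inv_point_def split: if_splits)
  have "A' = miquel_num (q 1) (q 2) (q 4) (q 3) (q 5)"
    by (simp add: assms(16) miquel_num_def)
  moreover have "B' = - miquel_num (q 2) (q 1) (q 4) (q 3) (q 6)"
    unfolding assms(17) S.num_other by simp
  ultimately have "A' - B' = miquel_den (q 1) (q 2) (q 4) (q 3) (q 5) (q 6)"
    and "M = q 1 + A' * inverse (A' - B') * (q 2 - q 1)"
    by (simp_all add: M_def miquel_pt_def miquel_den_def)
  with M S.den_nonzero show ?thesis by simp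
qed

end
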